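(* Let Assumptions 1 and 2 hold, let $\alpha\in(0,1)$, $b\in\mathcal B$, and let $\gamma\in(0,1)$. 1. If $Q(b)\ge C(\gamma)$, then $\mathbb P(T_n(b)>q_{1-\alpha}\mid\mathcal X_n)\ge\gamma$. 2. If $b\notin\mathcal B_n^*$, then the rejection probability $\mathbb P(T_n(b)>q_{1-\alpha}\mid\mathcal X_n)$ is at least $$1-\exp\left(-\frac12\left(\max\left\{0,\ \sqrt n\,Q(b)-q_{1-\alpha}\max\left\{\epsilon,(1+q_{1-\alpha}^2/n)^{-1/2}\right\}\right\}\right)^2\right).$$
   Context: Setting. $n,K\ge 1$ are integers; $Y_i\in\{0,1\}$, $X_i$ is a row vector in $\mathbb{R}^K$, $U_i$ is real valued, $i=1,\dots,n$; $\mathcal{X}_n\equiv(X_1,\dots,X_n)$. The analysis is conditional on $\mathcal{X}_n$ (it may be read for a fixed realization of $\mathcal{X}_n$). For any expression in $(Y,X)$, $\mathbb{E}_n[\cdot]\equiv n^{-1}\sum_{i=1}^n[\cdot]$, where $(Y,X)$ is evaluated at $(Y_i,X_i)$ in the $i$th summand. Assumption 1. (i) The random vectors $(Y_i,X_i,U_i)$, $i=1,\dots,n$, are defined on a probability space $(\Omega,\mathfrak F,\mathbb P)$, where $\mathfrak F$ contains the Borel sets on $\Omega$. (ii) $(Y_i,X_i)$, $i=1,\dots,n$, are observed. (iii) There is a column vector $\beta\in\mathbb{R}^K$ such that $\mathbb P(Y_i=1\{X_i\beta+U_i\ge 0\}\mid\mathcal X_n)=1$ and $\mathbb P(U_i\ge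 0\mid\mathcal X_n)=1/2$ for every $i$. (iv) $\beta$ belongs to a known set $\mathcal B\subseteq\mathbb R^K$. (v) $1\{U_1\ge0\},\dots,1\{U_n\ge0\}$ are mutually independent conditional on $\mathcal X_n$. Assumption 2. $U_1,\dots,U_n$ are mutually independent conditional on $\mathcal X_n$. Finite sample identified set. $\mathcal B_n^*$ is the set of $b\in\mathcal B$ for which there exist random variables $\tilde Y_1,\dots,\tilde Y_n$ and $\tilde U_1,\dots,\tilde U_n$ such that: (i) $\mathbb P(\tilde Y_i=1\{X_ib+\tilde U_i\ge0\}\mid\mathcal X_n)=1$ for every $i$; (ii) $(\tilde Y_1,\dots,\tilde Y_n)$ and $(Y_1,\dots,Y_n)$ have the same distribution conditional on $\mathcal X_n$; (iii) $\mathbb P(\tilde U_i\ge0\mid\mathcal X_n)=1/2$ for every $i$; (iv) $1\{\tilde U_1\ge0\},\dots,1\{\tilde U_n\ge0\}$ are mutually independent given $\mathcal X_n$. Test statistic. $\mathcal V_u,\mathcal V_l\subseteq\mathbb R^K$ are (nonempty) index sets and $\epsilon>0$ is a fixed (small) number. Define $\hat m_u(b,v)\equiv\mathbb E_n[(2Y-1)1\{Xb\ge0,Xv<0\}]$, $\hat m_l(b,v)\equiv\mathbb E_n[(1-2Y)1\{Xb\le0,Xv>0\}]$, $\hat\sigma_u^2(b,v)\equiv\mathbb E_n[1\{Xb\ge0,Xv<0\}]-\hat m_u(b,v)^2$, $\hat\sigma_l^2(b,v)\equiv\mathbb E_n[1\{Xb\le0,Xv>0\}]-\hat m_l(b,v)^2$,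 $\hat T_c(b,\mathcal V)\equiv\sup_{v\in\mathcal V}\sqrt n\,\frac{-\hat m_c(b,v)}{\max\{\hat\sigma_c(b,v),\epsilon\}}$ for $c\in\{u,l\}$, and $T_n(b)\equiv\max\{0,\hat T_u(b,\mathcal V_u),\hat T_l(b,\mathcal V_l)\}$. Critical value. Let $Y_i^*\equiv1\{U_i\ge0\}$ and let $T_n^*(b)$ be defined exactly as $T_n(b)$ but with $Y_i$ replaced by $Y_i^*$ for all $i$ (in the $\hat m$'s and hence in the $\hat\sigma$'s). Given $\mathcal X_n$, the variables $2Y_i^*-1$ are independent Rademacher variables. Define $q_{1-\alpha}\equiv\inf\{c\in\mathbb R:\mathbb P(T_n^*(b)\le c\mid\mathcal X_n)\ge1-\alpha\}$. Violation measure. $Q(b)\equiv\max\{Q_u(b),Q_l(b)\}$, where $Q_u(b)\equiv-\min\{0,\min_{v\in\mathcal V_u}\mathbb E[\mathbb E_n[(2Y-1)1\{Xv<0\le Xb\}]\mid\mathcal X_n]\}$, $Q_l(b)\equiv-\min\{0,\min_{v\in\mathcal V_l}\mathbb E[\mathbb E_n[(1-2Y)1\{Xb\le0<Xv\}]\mid\mathcal X_n]\}$. (The minima are attained because only finitely many values arise.) Also $$C(\gamma)\equiv\frac1{\sqrt n}\left(q_{1-\alpha}\max\left\{\epsilon,(1+q_{1-\alpha}^2/n)^{-1/2}\right\}+\sqrt{-2\log(1-\gamma)}\right).$$ *)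

theory Defs
  imports "HOL-Probability.Probability"
begin

text \<open>
  The analysis is conditional on the covariates, so they enter as a fixed realization
  \<open>X 1, \<dots>, X n\<close> in \<open>real ^ 'k\<close> and the measure \<open>M\<close> is the conditional probability given that
  realization. The product of the row vector \<open>X i\<close> and the column vector \<open>b\<close> is \<open>X i \<bullet> b\<close>.
  Outcomes in \<open>{0, 1}\<close> are represented as reals.
\<close>

definition binary_response_model ::
  "'w::topological_space measure \<Rightarrow> nat \<Rightarrow> (nat \<Rightarrow> real ^ 'k) \<Rightarrow> (real ^ 'k) set \<Rightarrow>
   (nat \<Rightarrow> 'w \<Rightarrow> real) \<Rightarrow> (nat \<Rightarrow> 'w \<Rightarrow> real) \<Rightarrow> bool" where
  "binary_response_model M n X B Y U \<longleftrightarrow>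
     prob_space M \<and>
     sets (restrict_space borel (space M)) \<subseteq> sets M \<and>
     (\<forall>i\<in>{1..n}. Y i \<in> borel_measurable M \<and> U i \<in> borel_measurable M) \<and>
     (\<forall>i\<in>{1..n}. \<forall>\<omega>\<in>space M. Y i \<omega> \<in> {0, 1}) \<and>
     (\<exists>\<beta>\<in>B. \<forall>i\<in>{1..n}.
        \<P>(\<omega> in M. Y i \<omega> = of_bool (X i \<bullet> \<beta> + U i \<omega> \<ge> 0)) = 1 \<and>
        \<P>(\<omega> in M. U i \<omega> \<ge> 0) = 1 / 2) \<and>
     prob_space.indep_vars M (\<lambda>_. borel) (\<lambda>i \<omega>. of_bool (U i \<omega> \<ge> 0) :: real) {1..n}"

definition independent_errors :: "'w measure \<Rightarrow> nat \<Rightarrow> (nat \<Rightarrow> 'w \<Rightarrow> real) \<Rightarrow> bool" where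
  "independent_errors M n U \<longleftrightarrow> prob_space.indep_vars M (\<lambda>_. borel) U {1..n}"

text \<open>
  The latent variables in the finite sample identified set live on the given probability space.
\<close>

definition identified_set ::
  "'w measure \<Rightarrow> nat \<Rightarrow> (nat \<Rightarrow> real ^ 'k) \<Rightarrow> (real ^ 'k) set \<Rightarrow> (nat \<Rightarrow> 'w \<Rightarrow> real) \<Rightarrow> (real ^ 'k) set"
where
  "identified_set M n X B Y = {b \<in> B. \<exists>Y' U'.
     (\<forall>i\<in>{1..n}. Y' i \<in> borel_measurable M \<and> U' i \<in> borel_measurable M) \<and>
     (\<forall>i\<in>{1..n}. \<P>(\<omega> in M. Y' i \<omega> = of_bool (X i \<bullet> b + U' i \<omega> \<ge> 0)) = 1) \<and>
     distr M (\<Pi>\<^sub>M i\<in>{1..n}. borel) (\<lambda>\<omega>. \<lambda>i\<in>{1..n}. Y' i \<omega>) =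
       distr M (\<Pi>\<^sub>M i\<in>{1..n}. borel) (\<lambda>\<omega>. \<lambda>i\<in>{1..n}. Y i \<omega>) \<and>
     (\<forall>i\<in>{1..n}. \<P>(\<omega> in M. U' i \<omega> \<ge> 0) = 1 / 2) \<and>
     prob_space.indep_vars M (\<lambda>_. borel) (\<lambda>i \<omega>. of_bool (U' i \<omega> \<ge> 0) :: real) {1..n}}"

text \<open>
  Sample quantities are functions of a realized outcome vector \<open>y\<close>, so that they can be
  evaluated both at \<open>Y\<close> and at \<open>Y\<^sup>*\<close>.
\<close>

definition sample_mean ::
  "nat \<Rightarrow> (nat \<Rightarrow> 'x) \<Rightarrow> (nat \<Rightarrow> real) \<Rightarrow> (real \<Rightarrow> 'x \<Rightarrow> real) \<Rightarrow> real" where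
  "sample_mean n X y g = (1 / real n) * (\<Sum>i\<in>{1..n}. g (y i) (X i))"

definition m_u ::
  "nat \<Rightarrow> (nat \<Rightarrow> real ^ 'k) \<Rightarrow> (nat \<Rightarrow> real) \<Rightarrow> real ^ 'k \<Rightarrow> real ^ 'k \<Rightarrow> real" where
  "m_u n X y b v = sample_mean n X y (\<lambda>y x. (2 * y - 1) * of_bool (x \<bullet> b \<ge> 0 \<and> x \<bullet> v < 0))"

definition m_l ::
  "nat \<Rightarrow> (nat \<Rightarrow> real ^ 'k) \<Rightarrow> (nat \<Rightarrow> real) \<Rightarrow> real ^ 'k \<Rightarrow> real ^ 'k \<Rightarrow> real" where
  "m_l n X y b v = sample_mean n X y (\<lambda>y x. (1 - 2 * y) * of_bool (x \<bullet> b \<le> 0 \<and> x \<bullet> v > 0))"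

definition sigma_u ::
  "nat \<Rightarrow> (nat \<Rightarrow> real ^ 'k) \<Rightarrow> (nat \<Rightarrow> real) \<Rightarrow> real ^ 'k \<Rightarrow> real ^ 'k \<Rightarrow> real" where
  "sigma_u n X y b v =
     sqrt (sample_mean n X y (\<lambda>y x. of_bool (x \<bullet> b \<ge> 0 \<and> x \<bullet> v < 0)) - (m_u n X y b v)\<^sup>2)"

definition sigma_l ::
  "nat \<Rightarrow> (nat \<Rightarrow> real ^ 'k) \<Rightarrow> (nat \<Rightarrow> real) \<Rightarrow> real ^ 'k \<Rightarrow> real ^ 'k \<Rightarrow> real" where
  "sigma_l n X y b v =
     sqrt (sample_mean n X y (\<lambda>y x. of_bool (x \<bullet> b \<le> 0 \<and> x \<bullet> v > 0)) - (m_l n X y b v)\<^sup>2)"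

text \<open>
  The moments depend on \<open>v\<close> only through the signs of the \<open>X i \<bullet> v\<close>, so every supremum and minimum
  over an index set below ranges over finitely many values.
\<close>

lemma finite_image_of_signs:
  assumes "\<And>v w. (\<And>i. i \<in> {1..n::nat} \<Longrightarrow> sgn (X i \<bullet> v) = sgn (X i \<bullet> w)) \<Longrightarrow> f v = f w"
  shows "finite (f ` (V :: (real ^ 'k) set))"
proof -
  define s where "s v = (\<lambda>i\<in>{1..n}. sgn (X i \<bullet> v))" for v :: "real ^ 'k"
  have "s v \<in> {1..n} \<rightarrow>\<^sub>E {-1, 0, 1}" for v
    by (auto simp: s_def sgn_real_def)
  then have "s ` V \<subseteq> {1..n} \<rightarrow>\<^sub>E {-1, 0, 1}"
    by blast
  then have fin: "finite (s ` V)"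
    by (rule finite_subset) (auto intro: finite_PiE)
  have "f v = f (SOME w. s w = s v)" for v
  proof (rule assms)
    fix i assume "i \<in> {1..n}"
    moreover have "s (SOME w. s w = s v) = s v"
      by (rule someI[where P = "\<lambda>w. s w = s v"]) simp
    ultimately show "sgn (X i \<bullet> v) = sgn (X i \<bullet> (SOME w. s w = s v))"
      by (metis restrict_apply' s_def)
  qed
  then have "f ` V = (\<lambda>t. f (SOME w. s w = t)) ` (s ` V)"
    by (auto simp: image_image)
  then show ?thesis
    using fin by simp
qed

definition T_u ::
  "nat \<Rightarrow> (nat \<Rightarrow> real ^ 'k) \<Rightarrow> real \<Rightarrow> (nat \<Rightarrow> real) \<Rightarrow> real ^ 'k \<Rightarrow> (real ^ 'k) set \<Rightarrow> real" where
  "T_u n X \<epsilon> y b V = (SUP v\<in>V. sqrt (real n) * (- m_u n X y b v / max (sigma_u n X y b v) \<epsilon>))"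

definition T_l ::
  "nat \<Rightarrow> (nat \<Rightarrow> real ^ 'k) \<Rightarrow> real \<Rightarrow> (nat \<Rightarrow> real) \<Rightarrow> real ^ 'k \<Rightarrow> (real ^ 'k) set \<Rightarrow> real" where
  "T_l n X \<epsilon> y b V = (SUP v\<in>V. sqrt (real n) * (- m_l n X y b v / max (sigma_l n X y b v) \<epsilon>))"

definition test_stat ::
  "nat \<Rightarrow> (nat \<Rightarrow> real ^ 'k) \<Rightarrow> (real ^ 'k) set \<Rightarrow> (real ^ 'k) set \<Rightarrow> real \<Rightarrow>
   (nat \<Rightarrow> real) \<Rightarrow> real ^ 'k \<Rightarrow> real" where
  "test_stat n X Vu Vl \<epsilon> y b = max 0 (max (T_u n X \<epsilon> y b Vu) (T_l n X \<epsilon> y b Vl))"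

definition crit_value ::
  "'w measure \<Rightarrow> nat \<Rightarrow> (nat \<Rightarrow> real ^ 'k) \<Rightarrow> (real ^ 'k) set \<Rightarrow> (real ^ 'k) set \<Rightarrow> real \<Rightarrow>
   (nat \<Rightarrow> 'w \<Rightarrow> real) \<Rightarrow> real \<Rightarrow> real ^ 'k \<Rightarrow> real" where
  "crit_value M n X Vu Vl \<epsilon> U \<alpha> b =
     Inf {c :: real. \<P>(\<omega> in M. test_stat n X Vu Vl \<epsilon> (\<lambda>i. of_bool (U i \<omega> \<ge> 0)) b \<le> c) \<ge> 1 - \<alpha>}"

definition Q_u ::
  "'w measure \<Rightarrow> nat \<Rightarrow> (nat \<Rightarrow> real ^ 'k) \<Rightarrow> (real ^ 'k) set \<Rightarrow> (nat \<Rightarrow> 'w \<Rightarrow> real) \<Rightarrow>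
   real ^ 'k \<Rightarrow> real" where
  "Q_u M n X Vu Y b = - min 0 (Min ((\<lambda>v. LINT \<omega>|M.
     sample_mean n X (\<lambda>i. Y i \<omega>) (\<lambda>y x. (2 * y - 1) * of_bool (x \<bullet> v < 0 \<and> 0 \<le> x \<bullet> b))) ` Vu))"

definition Q_l ::
  "'w measure \<Rightarrow> nat \<Rightarrow> (nat \<Rightarrow> real ^ 'k) \<Rightarrow> (real ^ 'k) set \<Rightarrow> (nat \<Rightarrow> 'w \<Rightarrow> real) \<Rightarrow>
   real ^ 'k \<Rightarrow> real" where
  "Q_l M n X Vl Y b = - min 0 (Min ((\<lambda>v. LINT \<omega>|M.
     sample_mean n X (\<lambda>i. Y i \<omega>) (\<lambda>y x. (1 - 2 * y) * of_bool (x \<bullet> b \<le> 0 \<and> 0 < x \<bullet> v))) ` Vl))"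

definition violation ::
  "'w measure \<Rightarrow> nat \<Rightarrow> (nat \<Rightarrow> real ^ 'k) \<Rightarrow> (real ^ 'k) set \<Rightarrow> (real ^ 'k) set \<Rightarrow>
   (nat \<Rightarrow> 'w \<Rightarrow> real) \<Rightarrow> real ^ 'k \<Rightarrow> real" where
  "violation M n X Vu Vl Y b = max (Q_u M n X Vu Y b) (Q_l M n X Vl Y b)"

definition C_bound :: "nat \<Rightarrow> real \<Rightarrow> real \<Rightarrow> real \<Rightarrow> real" where
  "C_bound n \<epsilon> q \<gamma> = (1 / sqrt (real n)) *
     (q * max \<epsilon> ((1 + q\<^sup>2 / real n) powr (- 1 / 2)) + sqrt (- 2 * ln (1 - \<gamma>)))"

end

theory Submission
  imports Defs
begin

text \<open>
  Let \<open>\<kappa> = q max {\<epsilon>, (1 + q\<^sup>2/n)\<^sup>-\<^sup>1\<^sup>/\<^sup>2}\<close>. As the squared standard error is at most \<open>1 - m\<^sup>2\<close>, a single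
  moment \<open>m\<close> with \<open>- sqrt n m > \<kappa>\<close> already has a studentized value above \<open>q\<close> and forces a rejection.
  Apply this to a moment attaining the violation measure, so that its mean is \<open>- Q\<close>. It is the
  average of \<open>n\<close> independent variables in \<open>[-1, 1]\<close>, so Hoeffding's inequality bounds the
  probability that \<open>- sqrt n m \<le> \<kappa>\<close> by \<open>exp (- (sqrt n Q - \<kappa>)\<^sup>2 / 2)\<close>.
\<close>

section \<open>From one large sample moment to a rejection\<close>

text \<open>The two terms of the threshold serve the two possible denominators. If the denominator
  is \<epsilon>, the first term suffices. If it is the standard error s, then s^2 \<le> 1 - m^2, so
  it is enough that q^2 (1 - m^2) < n m^2. Collecting the terms in m^2 turns this into q^2 / (1 +
  q^2 / n) < n m^2, which is the origin of the factor (1 + q^2 / n) to the power -1/2.\<close>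

lemma studentized_gt:
  fixes m p q \<epsilon> :: real
  assumes "n \<ge> 1" "p \<le> 1" "\<epsilon> > 0" "q \<ge> 0"
    and gt: "q * max \<epsilon> ((1 + q\<^sup>2 / real n) powr (- 1 / 2)) < sqrt (real n) * - m"
  shows "q < sqrt (real n) * (- m / max (sqrt (p - m\<^sup>2)) \<epsilon>)"
proof -
  define s where "s = sqrt (p - m\<^sup>2)"
  define w where "w = (1 + q\<^sup>2 / real n) powr (- 1 / 2)"
  have n: "real n > 0" using assms by simp
  have pos: "1 + q\<^sup>2 / real n > 0"
    using n by (simp add: add_pos_nonneg)
  have w2: "w\<^sup>2 = 1 / (1 + q\<^sup>2 / real n)"
    using powr_neg_one[OF pos] by (simp add: w_def power2_eq_square flip: powr_add)
  have w0: "w \<ge> 0" by (simp add: w_def)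
  have qe: "q * \<epsilon> < sqrt (real n) * - m"
    using gt assms(4) by (smt (verit) max.cobounded1 mult_left_mono)
  have qw: "q * w < sqrt (real n) * - m"
    using gt assms(4) unfolding w_def by (smt (verit) max.cobounded2 mult_left_mono)
  have qs: "q * s < sqrt (real n) * - m" if "s > \<epsilon>"
  proof -
    \<comment> \<open>\<open>sqrt\<close> of a negative real is negative, so positivity of s makes
      the radicand positive and lets s^2 be replaced by it.\<close>
    have "s > 0" using that assms by simp
    then have "p - m\<^sup>2 > 0" by (simp add: s_def)
    then have s2: "s\<^sup>2 \<le> 1 - m\<^sup>2" using assms by (simp add: s_def)
    have "(q * w)\<^sup>2 < (sqrt (real n) * - m)\<^sup>2"
      using qw assms(4) w0 by (intro power_strict_mono) auto
    then have "q\<^sup>2 / (1 + q\<^sup>2 / real n) < real n * m\<^sup>2"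
      using w2 by (simp add: power_mult_distrib)
    then have "q\<^sup>2 < real n * m\<^sup>2 * (1 + q\<^sup>2 / real n)"
      using pos by (simp add: pos_divide_less_eq)
    also have "\<dots> = real n * m\<^sup>2 + q\<^sup>2 * m\<^sup>2"
      using n by (simp add: field_simps)
    finally have "q\<^sup>2 * (1 - m\<^sup>2) < real n * m\<^sup>2"
      by (simp add: algebra_simps)
    moreover have "q\<^sup>2 * s\<^sup>2 \<le> q\<^sup>2 * (1 - m\<^sup>2)"
      using s2 by (intro mult_left_mono) auto
    ultimately have "(q * s)\<^sup>2 < (sqrt (real n) * - m)\<^sup>2"
      by (simp add: power_mult_distrib)
    moreover have "0 \<le> sqrt (real n) * - m"
      using qe assms by (smt (verit) mult_nonneg_nonneg)
    ultimately show ?thesis by (rule power2_less_imp_less)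
  qed
  have "q * max s \<epsilon> < sqrt (real n) * - m"
    using qe qs by (auto simp: max_def)
  moreover have "max s \<epsilon> > 0" using assms by simp
  ultimately have "q < sqrt (real n) * - m / max s \<epsilon>"
    by (simp only: pos_less_divide_eq)
  then show ?thesis by (simp add: s_def)
qed

lemma sample_mean_of_bool_le_1:
  assumes "n \<ge> 1"
  shows "sample_mean n X y (\<lambda>_ x. of_bool (P x)) \<le> 1"
proof -
  have "(\<Sum>i\<in>{1..n}. of_bool (P (X i)) :: real) \<le> (\<Sum>i\<in>{1..n}. 1)"
    by (intro sum_mono) auto
  then show ?thesis using assms by (simp add: sample_mean_def field_simps)
qed

lemma sample_mean_cong:
  assumes "\<And>i. i \<in> {1..n} \<Longrightarrow> g (y i) (X i) = h (z i) (X i)"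
  shows "sample_mean n X y g = sample_mean n X z h"
  unfolding sample_mean_def by (intro arg_cong2[where f = "(*)"] refl sum.cong assms)

text \<open>Supplies the hypothesis of \<open>finite_image_of_signs\<close>, both for the suprema in
  the test statistic and for the minima in the violation measure.\<close>

lemma sample_moments_sgn_cong:
  fixes X :: "nat \<Rightarrow> real ^ 'k"
  assumes "\<And>i. i \<in> {1..n} \<Longrightarrow> sgn (X i \<bullet> v) = sgn (X i \<bullet> w)"
  shows "m_u n X y b v = m_u n X y b w" "m_l n X y b v = m_l n X y b w"
    "sigma_u n X y b v = sigma_u n X y b w" "sigma_l n X y b v = sigma_l n X y b w"
proof -
  have neg: "X i \<bullet> v < 0 \<longleftrightarrow> X i \<bullet> w < 0" if "i \<in> {1..n}" for i
    using assms[OF that] by (metis sgn_less)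
  have pos: "0 < X i \<bullet> v \<longleftrightarrow> 0 < X i \<bullet> w" if "i \<in> {1..n}" for i
    using assms[OF that] by (metis sgn_greater)
  show mu: "m_u n X y b v = m_u n X y b w"
    unfolding m_u_def by (rule sample_mean_cong) (simp only: neg)
  show ml: "m_l n X y b v = m_l n X y b w"
    unfolding m_l_def by (rule sample_mean_cong) (simp only: pos)
  show "sigma_u n X y b v = sigma_u n X y b w"
    unfolding sigma_u_def mu
    by (intro arg_cong[where f = sqrt] arg_cong2[where f = "(-)"] refl sample_mean_cong)
       (simp only: neg)
  show "sigma_l n X y b v = sigma_l n X y b w"
    unfolding sigma_l_def ml
    by (intro arg_cong[where f = sqrt] arg_cong2[where f = "(-)"] refl sample_mean_cong)
       (simp only: pos)
qed

lemma test_stat_gt: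
  fixes X :: "nat \<Rightarrow> real ^ 'k"
  assumes "n \<ge> 1" "\<epsilon> > 0" "q \<ge> 0"
    and "(\<exists>v\<in>Vu. q * max \<epsilon> ((1 + q\<^sup>2 / real n) powr (- 1 / 2)) < sqrt (real n) * - m_u n X y b v)
       \<or> (\<exists>v\<in>Vl. q * max \<epsilon> ((1 + q\<^sup>2 / real n) powr (- 1 / 2)) < sqrt (real n) * - m_l n X y b v)"
  shows "q < test_stat n X Vu Vl \<epsilon> y b"
proof -
  \<comment> \<open>A real \<open>SUP\<close> is guaranteed to dominate the members of the family
    only if the family is bounded above. Finiteness of the set of values provides that, with no
    restriction on the index set.\<close>
  have fu: "finite ((\<lambda>v. sqrt (real n) * (- m_u n X y b v / max (sigma_u n X y b v) \<epsilon>)) ` Vu)"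
  proof (rule finite_image_of_signs[where n = n and X = X])
    fix v w :: "real ^ 'k"
    assume "\<And>i. i \<in> {1..n} \<Longrightarrow> sgn (X i \<bullet> v) = sgn (X i \<bullet> w)"
    from sample_moments_sgn_cong[OF this]
    show "sqrt (real n) * (- m_u n X y b v / max (sigma_u n X y b v) \<epsilon>) =
      sqrt (real n) * (- m_u n X y b w / max (sigma_u n X y b w) \<epsilon>)"
      by (simp only:)
  qed
  have fl: "finite ((\<lambda>v. sqrt (real n) * (- m_l n X y b v / max (sigma_l n X y b v) \<epsilon>)) ` Vl)"
  proof (rule finite_image_of_signs[where n = n and X = X])
    fix v w :: "real ^ 'k"
    assume "\<And>i. i \<in> {1..n} \<Longrightarrow> sgn (X i \<bullet> v) = sgn (X i \<bullet> w)"
    from sample_moments_sgn_cong[OF this]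
    show "sqrt (real n) * (- m_l n X y b v / max (sigma_l n X y b v) \<epsilon>) =
      sqrt (real n) * (- m_l n X y b w / max (sigma_l n X y b w) \<epsilon>)"
      by (simp only:)
  qed
  from assms(4) show ?thesis
  proof (elim disjE bexE)
    fix v assume v: "v \<in> Vu"
      and "q * max \<epsilon> ((1 + q\<^sup>2 / real n) powr (- 1 / 2)) < sqrt (real n) * - m_u n X y b v"
    then have "q < sqrt (real n) * (- m_u n X y b v / max (sigma_u n X y b v) \<epsilon>)"
      unfolding sigma_u_def using assms by (intro studentized_gt sample_mean_of_bool_le_1)
    also have "\<dots> \<le> T_u n X \<epsilon> y b Vu"
      unfolding T_u_def by (rule cSUP_upper[OF v bdd_above_finite[OF fu]])
    finally show ?thesis by (simp add: test_stat_def)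
  next
    fix v assume v: "v \<in> Vl"
      and "q * max \<epsilon> ((1 + q\<^sup>2 / real n) powr (- 1 / 2)) < sqrt (real n) * - m_l n X y b v"
    then have "q < sqrt (real n) * (- m_l n X y b v / max (sigma_l n X y b v) \<epsilon>)"
      unfolding sigma_l_def using assms by (intro studentized_gt sample_mean_of_bool_le_1)
    also have "\<dots> \<le> T_l n X \<epsilon> y b Vl"
      unfolding T_l_def by (rule cSUP_upper[OF v bdd_above_finite[OF fl]])
    finally show ?thesis by (simp add: test_stat_def)
  qed
qed

section \<open>Finitely many outcome vectors: measurability and the critical value\<close>

lemma test_stat_cong:
  fixes X :: "nat \<Rightarrow> real ^ 'k"
  assumes "\<And>i. i \<in> {1..n} \<Longrightarrow> y i = y' i"
  shows "test_stat n X Vu Vl \<epsilon> y b = test_stat n X Vu Vl \<epsilon> y' b"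
proof -
  have "sample_mean n X y g = sample_mean n X y' g" for g :: "real \<Rightarrow> real ^ 'k \<Rightarrow> real"
    by (rule sample_mean_cong) (simp only: assms)
  then show ?thesis
    by (simp add: test_stat_def T_u_def T_l_def sigma_u_def sigma_l_def m_u_def m_l_def)
qed

lemma test_stat_restrict:
  "test_stat n X Vu Vl \<epsilon> (restrict y {1..n}) b = test_stat n X Vu Vl \<epsilon> y b"
  by (rule test_stat_cong) simp

text \<open>The suprema may run over uncountable index sets, so measurability is obtained from the
  outcomes instead: only finitely many 0-1 vectors of length n exist, and the event is the finite
  union, over the rejecting vectors, of the events that this vector is realized.\<close>

lemma measurable_test_stat_gt:
  fixes X :: "nat \<Rightarrow> real ^ 'k"
  assumes "\<And>i. i \<in> {1..n} \<Longrightarrow> Y i \<in> borel_measurable M"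
    and "\<And>i \<omega>. i \<in> {1..n} \<Longrightarrow> \<omega> \<in> space M \<Longrightarrow> Y i \<omega> \<in> {0, 1 :: real}"
  shows "{\<omega> \<in> space M. q < test_stat n X Vu Vl \<epsilon> (\<lambda>i. Y i \<omega>) b} \<in> sets M"
proof -
  \<comment> \<open>Extensional functions on \<open>{1..n}\<close> make \<open>R\<close> finite. By
    \<open>test_stat_restrict\<close> the statistic does not notice the restriction.\<close>
  define R where "R = {y \<in> {1..n} \<rightarrow>\<^sub>E {0, 1 :: real}. q < test_stat n X Vu Vl \<epsilon> y b}"
  have "finite R" by (simp add: R_def finite_PiE)
  moreover have "{\<omega> \<in> space M. \<forall>i\<in>{1..n}. Y i \<omega> = y i} \<in> sets M" for y
    using assms(1) by measurable
  ultimately have "(\<Union>y\<in>R. {\<omega> \<in> space M. \<forall>i\<in>{1..n}. Y i \<omega> = y i}) \<in> sets M"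
    by blast
  also have "(\<Union>y\<in>R. {\<omega> \<in> space M. \<forall>i\<in>{1..n}. Y i \<omega> = y i}) =
    {\<omega> \<in> space M. q < test_stat n X Vu Vl \<epsilon> (\<lambda>i. Y i \<omega>) b}"
  proof (intro equalityI subsetI)
    fix \<omega> assume "\<omega> \<in> (\<Union>y\<in>R. {\<omega> \<in> space M. \<forall>i\<in>{1..n}. Y i \<omega> = y i})"
    then obtain y where "y \<in> R" "\<omega> \<in> space M" "\<And>i. i \<in> {1..n} \<Longrightarrow> Y i \<omega> = y i" by blast
    then show "\<omega> \<in> {\<omega> \<in> space M. q < test_stat n X Vu Vl \<epsilon> (\<lambda>i. Y i \<omega>) b}"
      using test_stat_cong[of n "\<lambda>i. Y i \<omega>" y X Vu Vl \<epsilon> b] by (simp add: R_def)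
  next
    fix \<omega> assume \<omega>: "\<omega> \<in> {\<omega> \<in> space M. q < test_stat n X Vu Vl \<epsilon> (\<lambda>i. Y i \<omega>) b}"
    then have "(\<lambda>i\<in>{1..n}. Y i \<omega>) \<in> R"
      using assms(2) unfolding R_def mem_Collect_eq test_stat_restrict by auto
    then show "\<omega> \<in> (\<Union>y\<in>R. {\<omega> \<in> space M. \<forall>i\<in>{1..n}. Y i \<omega> = y i})"
      using \<omega> by (intro UN_I[of "\<lambda>i\<in>{1..n}. Y i \<omega>"]) auto
  qed
  finally show ?thesis .
qed

text \<open>The statistic is at least 0, so a negative c has probability 0 < 1 - \<alpha> and is
  excluded from the set whose infimum is taken. The set must also be shown nonempty, since
  \<open>Inf\<close> of the empty set says nothing. Nonnegativity of q is what permits squaring in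
  \<open>studentized_gt\<close>.\<close>

lemma crit_value_nonneg:
  assumes "prob_space M" "0 < \<alpha>" "\<alpha> < 1"
  shows "crit_value M n X Vu Vl \<epsilon> U \<alpha> b \<ge> 0"
proof -
  interpret prob_space M by fact
  define T where "T \<omega> = test_stat n X Vu Vl \<epsilon> (\<lambda>i. of_bool (U i \<omega> \<ge> 0)) b" for \<omega>
  define S where "S = {c :: real. \<P>(\<omega> in M. T \<omega> \<le> c) \<ge> 1 - \<alpha>}"
  have "T ` space M \<subseteq> (\<lambda>y. test_stat n X Vu Vl \<epsilon> y b) ` ({1..n} \<rightarrow>\<^sub>E {0, 1})"
  proof (rule image_subsetI)
    fix \<omega>
    show "T \<omega> \<in> (\<lambda>y. test_stat n X Vu Vl \<epsilon> y b) ` ({1..n} \<rightarrow>\<^sub>E {0, 1})"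
    proof (rule image_eqI)
      show "T \<omega> = test_stat n X Vu Vl \<epsilon> (\<lambda>i\<in>{1..n}. of_bool (U i \<omega> \<ge> 0)) b"
        unfolding T_def by (rule test_stat_restrict[symmetric])
    qed auto
  qed
  then have "finite (T ` space M)"
    by (rule finite_subset) (simp add: finite_PiE)
  \<comment> \<open>The largest of the finitely many values of \<open>T\<close> bounds it
    everywhere, so it is a member of \<open>S\<close>.\<close>
  then have "\<P>(\<omega> in M. T \<omega> \<le> Max (T ` space M)) = prob (space M)"
    by (intro arg_cong[where f = prob]) auto
  then have "S \<noteq> {}"
    using assms by (auto simp: S_def prob_space intro!: exI[of _ "Max (T ` space M)"])
  moreover have "0 \<le> c" if "c \<in> S" for c
  proof (rule ccontr)
    assume "\<not> 0 \<le> c"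
    then have "{\<omega> \<in> space M. T \<omega> \<le> c} = {}"
      by (auto simp: T_def test_stat_def)
    then have "\<P>(\<omega> in M. T \<omega> \<le> c) = 0"
      by (simp only: measure_empty)
    then show False using that assms by (simp add: S_def)
  qed
  ultimately show ?thesis
    unfolding crit_value_def S_def T_def by (intro cInf_greatest)
qed

section \<open>Concentration of weighted means of the outcome signs\<close>

text \<open>In the model the outcomes equal indicators of the errors only almost surely. The version
  \<open>Z\<close> carries the independence and the pointwise bounds, Hoeffding's inequality is
  applied to it, and the change on a null set affects neither the mean nor the tail
  probability.\<close>

lemma Hoeffding_sign_mean_ge:
  fixes Y Z :: "nat \<Rightarrow> 'w \<Rightarrow> real" and a :: "nat \<Rightarrow> real"
  assumes "prob_space M" "n \<ge> 1" "\<delta> \<ge> 0"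
    and indep: "prob_space.indep_vars M (\<lambda>_. borel) Z {1..n}"
    and Y: "\<And>i. i \<in> {1..n} \<Longrightarrow> Y i \<in> borel_measurable M"
    and eq: "\<And>i. i \<in> {1..n} \<Longrightarrow> AE \<omega> in M. Y i \<omega> = Z i \<omega>"
    and Z01: "\<And>i \<omega>. i \<in> {1..n} \<Longrightarrow> Z i \<omega> \<in> {0..1}"
    and a: "\<And>i. i \<in> {1..n} \<Longrightarrow> \<bar>a i\<bar> \<le> 1"
  defines "m \<equiv> \<lambda>\<omega>. (1 / real n) * (\<Sum>i\<in>{1..n}. (2 * Y i \<omega> - 1) * a i)"
  shows "\<P>(\<omega> in M. m \<omega> \<ge> (LINT \<omega>|M. m \<omega>) + \<delta>) \<le> exp (- (real n * \<delta>\<^sup>2 / 2))"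
proof -
  interpret prob_space M by fact
  have Z: "Z i \<in> borel_measurable M" if "i \<in> {1..n}" for i
    using indep that unfolding indep_vars_def by blast
  define W where "W i \<omega> = (2 * Z i \<omega> - 1) * a i" for i \<omega>
  have W: "W i \<in> borel_measurable M" if "i \<in> {1..n}" for i
    using Z[OF that] unfolding W_def by measurable
  have m [measurable]: "m \<in> borel_measurable M"
    using Y unfolding m_def by measurable
  have mW: "AE \<omega> in M. real n * m \<omega> = (\<Sum>i\<in>{1..n}. W i \<omega>)"
  proof -
    have "AE \<omega> in M. \<forall>i\<in>{1..n}. Y i \<omega> = Z i \<omega>"
      using eq by (intro AE_finite_allI) auto
    then show ?thesis
      by eventually_elim (use assms in \<open>simp add: m_def W_def\<close>)
  qed
  have W1: "\<bar>W i \<omega>\<bar> \<le> 1" if "i \<in> {1..n}" for i \<omega>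
  proof -
    have "\<bar>2 * Z i \<omega> - 1\<bar> \<le> 1" using Z01[OF that, of \<omega>] by auto
    then show ?thesis using a[OF that] by (simp add: W_def abs_mult mult_le_one)
  qed
  interpret H: Hoeffding_ineq M "{1..n}" W "\<lambda>_. -1" "\<lambda>_. 1" "\<Sum>i\<in>{1..n}. expectation (W i)"
  proof unfold_locales
    show "indep_vars (\<lambda>_. borel) W {1..n}"
      unfolding W_def by (rule indep_vars_compose2[OF indep]) measurable
    show "AE \<omega> in M. W i \<omega> \<in> {- 1..1}" if "i \<in> {1..n}" for i
      using W1[OF that] by (auto simp: abs_le_iff minus_le_iff)
  qed auto
  have "integrable M (W i)" if "i \<in> {1..n}" for i
    using W[OF that] W1[OF that] by (intro integrable_const_bound[where B = 1]) auto
  then have "(\<Sum>i\<in>{1..n}. expectation (W i)) = expectation (\<lambda>\<omega>. \<Sum>i\<in>{1..n}. W i \<omega>)"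
    by simp
  also have "\<dots> = expectation (\<lambda>\<omega>. real n * m \<omega>)"
    using mW W by (intro integral_cong_AE) (auto elim!: eventually_mono)
  finally have E: "(\<Sum>i\<in>{1..n}. expectation (W i)) = real n * expectation m"
    by simp
  have "\<P>(\<omega> in M. m \<omega> \<ge> expectation m + \<delta>) =
    \<P>(\<omega> in M. (\<Sum>i\<in>{1..n}. W i \<omega>) \<ge> real n * expectation m + real n * \<delta>)"
  proof (rule measure_eq_AE)
    show "AE \<omega> in M. \<omega> \<in> {\<omega> \<in> space M. m \<omega> \<ge> expectation m + \<delta>} \<longleftrightarrow>
      \<omega> \<in> {\<omega> \<in> space M. (\<Sum>i\<in>{1..n}. W i \<omega>) \<ge> real n * expectation m + real n * \<delta>}"
      using mW
    proof eventually_elim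
      case (elim \<omega>)
      have "real n * expectation m + real n * \<delta> \<le> real n * m \<omega> \<longleftrightarrow> expectation m + \<delta> \<le> m \<omega>"
        using assms(2) by (simp flip: distrib_left)
      then show ?case using elim by simp
    qed
    show "{\<omega> \<in> space M. (\<Sum>i\<in>{1..n}. W i \<omega>) \<ge> real n * expectation m + real n * \<delta>} \<in> sets M"
      using W by measurable
  qed measurable
  \<comment> \<open>The deviation of the sum is n \<delta>, and each of the n summands ranges over
    an interval of length 2, so the exponent is - 2 (n \<delta>)^2 / (4 n).\<close>
  also have "\<dots> \<le> exp (- 2 * (real n * \<delta>)\<^sup>2 / (\<Sum>i\<in>{1..n}. (1 - (- 1))\<^sup>2))"
    using H.Hoeffding_ineq_ge[of "real n * \<delta>"] assms(2,3) unfolding E by simp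
  also have "- 2 * (real n * \<delta>)\<^sup>2 / (\<Sum>i\<in>{1..n}. (1 - (- 1))\<^sup>2) = - (real n * \<delta>\<^sup>2 / 2)"
    using assms(2) by (simp add: power2_eq_square)
  finally show ?thesis .
qed

text \<open>The weights \<open>a\<close> cover both families of moments, with an indicator for the
  upper one and a negated indicator for the lower one. The event \<open>P\<close> stands for
  rejection: it contains the complement of an upper tail event of \<open>m\<close>, whose
  probability Hoeffding's inequality bounds.\<close>

lemma prob_ge_of_sign_mean:
  fixes M :: "'w::topological_space measure" and X :: "nat \<Rightarrow> real ^ 'k"
  assumes model: "binary_response_model M n X B Y U" and ind: "independent_errors M n U"
    and "n \<ge> 1" and R: "{\<omega> \<in> space M. P \<omega>} \<in> sets M"
    and a: "\<And>i. i \<in> {1..n} \<Longrightarrow> \<bar>a i\<bar> \<le> 1"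
  defines "m \<equiv> \<lambda>\<omega>. (1 / real n) * (\<Sum>i\<in>{1..n}. (2 * Y i \<omega> - 1) * a i)"
  assumes imp: "\<And>\<omega>. \<omega> \<in> space M \<Longrightarrow> \<kappa> < sqrt (real n) * - m \<omega> \<Longrightarrow> P \<omega>"
  shows "\<P>(\<omega> in M. P \<omega>) \<ge>
    1 - exp (- (1 / 2) * (max 0 (sqrt (real n) * - (LINT \<omega>|M. m \<omega>) - \<kappa>))\<^sup>2)"
proof (cases "sqrt (real n) * - (LINT \<omega>|M. m \<omega>) \<le> \<kappa>")
  \<comment> \<open>Here the maximum is 0, so the claimed lower bound is 1 - exp 0 = 0.\<close>
  case True
  then show ?thesis by (simp add: max_def)
next
  case False
  interpret prob_space M using model by (simp add: binary_response_model_def)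
  have Y: "Y i \<in> borel_measurable M" if "i \<in> {1..n}" for i
    using model that by (simp add: binary_response_model_def)
  have U: "indep_vars (\<lambda>_. borel) U {1..n}"
    using ind by (simp add: independent_errors_def)
  from model obtain \<beta> where
    \<beta>: "\<And>i. i \<in> {1..n} \<Longrightarrow> \<P>(\<omega> in M. Y i \<omega> = of_bool (X i \<bullet> \<beta> + U i \<omega> \<ge> 0)) = 1"
    unfolding binary_response_model_def by blast
  \<comment> \<open>Chosen so that the mean of \<open>m\<close> plus \<delta> is - \<kappa> / sqrt
    n. The tail event is then exactly the event that - sqrt n m \<le> \<kappa>.\<close>
  define \<delta> where "\<delta> = - \<kappa> / sqrt (real n) - (LINT \<omega>|M. m \<omega>)"
  have n: "sqrt (real n) > 0" using assms by simp
  have \<delta>: "sqrt (real n) * \<delta> = sqrt (real n) * - (LINT \<omega>|M. m \<omega>) - \<kappa>"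
    using n by (simp add: \<delta>_def field_simps)
  then have "\<delta> \<ge> 0"
    using False n by (smt (verit) mult_pos_neg)
  have tail: "\<P>(\<omega> in M. m \<omega> \<ge> (LINT \<omega>|M. m \<omega>) + \<delta>) \<le> exp (- (real n * \<delta>\<^sup>2 / 2))"
    unfolding m_def
  proof (rule Hoeffding_sign_mean_ge[where Z = "\<lambda>i \<omega>. of_bool (X i \<bullet> \<beta> + U i \<omega> \<ge> 0)"])
    \<comment> \<open>The cutoff for \<open>U i\<close> is \<open>- (X i \<bullet> \<beta>)\<close>
      rather than 0, so independence has to come from the errors themselves and not merely from
      their signs.\<close>
    show "indep_vars (\<lambda>_. borel) (\<lambda>i \<omega>. of_bool (X i \<bullet> \<beta> + U i \<omega> \<ge> 0) :: real) {1..n}"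
      by (rule indep_vars_compose2[OF U]) measurable
    show "AE \<omega> in M. Y i \<omega> = of_bool (X i \<bullet> \<beta> + U i \<omega> \<ge> 0)" if "i \<in> {1..n}" for i
      using AE_prob_1[OF \<beta>[OF that]] by auto
  qed (use assms Y a \<open>\<delta> \<ge> 0\<close> prob_space_axioms in auto)
  have m [measurable]: "m \<in> borel_measurable M"
    using Y unfolding m_def by measurable
  have iff: "m \<omega> \<ge> (LINT \<omega>|M. m \<omega>) + \<delta> \<longleftrightarrow> sqrt (real n) * - m \<omega> \<le> \<kappa>" for \<omega>
    using n by (simp add: \<delta>_def field_simps) linarith
  have "1 - exp (- (real n * \<delta>\<^sup>2 / 2)) \<le> 1 - \<P>(\<omega> in M. m \<omega> \<ge> (LINT \<omega>|M. m \<omega>) + \<delta>)"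
    using tail by simp
  also have "\<dots> = \<P>(\<omega> in M. \<not> m \<omega> \<ge> (LINT \<omega>|M. m \<omega>) + \<delta>)"
    by (rule prob_neg[symmetric]) measurable
  also have "\<dots> \<le> \<P>(\<omega> in M. P \<omega>)"
    using imp R by (intro finite_measure_mono) (auto simp: iff)
  also have "real n * \<delta>\<^sup>2 = (sqrt (real n) * - (LINT \<omega>|M. m \<omega>) - \<kappa>)\<^sup>2"
    unfolding \<delta>[symmetric] by (simp add: power_mult_distrib)
  finally show ?thesis using False by (simp add: max_def)
qed

section \<open>The violation measure and the rejection probability\<close>

text \<open>Finitely many sign patterns give finitely many mean moments, so the minimum is the value
  at some v. Truncation at 0 accounts for the other alternative.\<close>

lemma Q_u_attained:
  fixes X :: "nat \<Rightarrow> real ^ 'k"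
  assumes "Vu \<noteq> {}"
  shows "Q_u M n X Vu Y b = 0 \<or> (\<exists>v\<in>Vu. Q_u M n X Vu Y b = - (LINT \<omega>|M. m_u n X (\<lambda>i. Y i \<omega>) b v))"
proof -
  define f where "f v = (LINT \<omega>|M. m_u n X (\<lambda>i. Y i \<omega>) b v)" for v
  have "finite (f ` Vu)"
    unfolding f_def by (rule finite_image_of_signs[where n = n and X = X])
      (intro Bochner_Integration.integral_cong refl sample_moments_sgn_cong)
  then have "Min (f ` Vu) \<in> f ` Vu" using assms by (intro Min_in) auto
  moreover have "Q_u M n X Vu Y b = - min 0 (Min (f ` Vu))"
    by (simp add: Q_u_def f_def m_u_def conj_commute)
  ultimately show ?thesis by (auto simp: min_def f_def)
qed

lemma Q_l_attained:
  fixes X :: "nat \<Rightarrow> real ^ 'k"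
  assumes "Vl \<noteq> {}"
  shows "Q_l M n X Vl Y b = 0 \<or> (\<exists>v\<in>Vl. Q_l M n X Vl Y b = - (LINT \<omega>|M. m_l n X (\<lambda>i. Y i \<omega>) b v))"
proof -
  define f where "f v = (LINT \<omega>|M. m_l n X (\<lambda>i. Y i \<omega>) b v)" for v
  have "finite (f ` Vl)"
    unfolding f_def by (rule finite_image_of_signs[where n = n and X = X])
      (intro Bochner_Integration.integral_cong refl sample_moments_sgn_cong)
  then have "Min (f ` Vl) \<in> f ` Vl" using assms by (intro Min_in) auto
  moreover have "Q_l M n X Vl Y b = - min 0 (Min (f ` Vl))"
    by (simp add: Q_l_def f_def m_l_def)
  ultimately show ?thesis by (auto simp: min_def f_def)
qed

text \<open>A positive violation is minus the mean of a single upper or lower moment, so the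
  concentration bound for that moment gives the bound for the test.\<close>

lemma rejection_prob_ge:
  fixes M :: "'w::topological_space measure" and X :: "nat \<Rightarrow> real ^ 'k"
  assumes "n \<ge> 1" and model: "binary_response_model M n X B Y U" and ind: "independent_errors M n U"
    and "Vu \<noteq> {}" "Vl \<noteq> {}" "\<epsilon> > 0" "q \<ge> 0"
  shows "\<P>(\<omega> in M. test_stat n X Vu Vl \<epsilon> (\<lambda>i. Y i \<omega>) b > q) \<ge>
    1 - exp (- (1 / 2) * (max 0 (sqrt (real n) * violation M n X Vu Vl Y b
      - q * max \<epsilon> ((1 + q\<^sup>2 / real n) powr (- 1 / 2))))\<^sup>2)"
proof -
  define \<kappa> where "\<kappa> = q * max \<epsilon> ((1 + q\<^sup>2 / real n) powr (- 1 / 2))"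
  have "\<kappa> \<ge> 0" using assms by (simp add: \<kappa>_def le_max_iff_disj)
  have meas: "{\<omega> \<in> space M. q < test_stat n X Vu Vl \<epsilon> (\<lambda>i. Y i \<omega>) b} \<in> sets M"
    using model by (intro measurable_test_stat_gt) (auto simp: binary_response_model_def)
  note reject = prob_ge_of_sign_mean[OF model ind assms(1) meas, where \<kappa> = \<kappa>]
  have "violation M n X Vu Vl Y b = 0 \<or>
      (\<exists>v\<in>Vu. violation M n X Vu Vl Y b = - (LINT \<omega>|M. m_u n X (\<lambda>i. Y i \<omega>) b v)) \<or>
      (\<exists>v\<in>Vl. violation M n X Vu Vl Y b = - (LINT \<omega>|M. m_l n X (\<lambda>i. Y i \<omega>) b v))"
    using Q_u_attained[OF assms(4), of M n X Y b] Q_l_attained[OF assms(5), of M n X Y b]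
    by (auto simp: violation_def max_def)
  then show ?thesis
  proof (elim disjE bexE)
    \<comment> \<open>Since \<kappa> \<ge> 0, the maximum vanishes and the bound is 0.\<close>
    assume "violation M n X Vu Vl Y b = 0"
    then show ?thesis using \<open>\<kappa> \<ge> 0\<close> unfolding \<kappa>_def[symmetric] by simp
  next
    fix v assume v: "v \<in> Vu"
      and Q: "violation M n X Vu Vl Y b = - (LINT \<omega>|M. m_u n X (\<lambda>i. Y i \<omega>) b v)"
    have eq: "m_u n X (\<lambda>i. Y i \<omega>) b v =
      (1 / real n) * (\<Sum>i\<in>{1..n}. (2 * Y i \<omega> - 1) * of_bool (X i \<bullet> b \<ge> 0 \<and> X i \<bullet> v < 0))" for \<omega>
      by (simp add: m_u_def sample_mean_def)
    show ?thesis
      unfolding Q eq \<kappa>_def[symmetric]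
    proof (rule reject)
      show "q < test_stat n X Vu Vl \<epsilon> (\<lambda>i. Y i \<omega>) b"
        if "\<kappa> < sqrt (real n) * - ((1 / real n) *
          (\<Sum>i\<in>{1..n}. (2 * Y i \<omega> - 1) * of_bool (X i \<bullet> b \<ge> 0 \<and> X i \<bullet> v < 0)))" for \<omega>
        using that[folded eq] v assms unfolding \<kappa>_def by (intro test_stat_gt) blast+
    qed simp
  next
    fix v assume v: "v \<in> Vl"
      and Q: "violation M n X Vu Vl Y b = - (LINT \<omega>|M. m_l n X (\<lambda>i. Y i \<omega>) b v)"
    \<comment> \<open>Moving the sign of 1 - 2 Y into the weight brings the lower moment into the
      form with 2 Y - 1.\<close>
    have eq: "m_l n X (\<lambda>i. Y i \<omega>) b v =
      (1 / real n) * (\<Sum>i\<in>{1..n}. (2 * Y i \<omega> - 1) * - of_bool (X i \<bullet> b \<le> 0 \<and> X i \<bullet> v > 0))" for \<omega>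
    proof -
      have "(1 - 2 * y) * c = (2 * y - 1) * - c" for y c :: real
        by (simp add: algebra_simps)
      then show ?thesis by (simp only: m_l_def sample_mean_def)
    qed
    show ?thesis
      unfolding Q eq \<kappa>_def[symmetric]
    proof (rule reject)
      show "q < test_stat n X Vu Vl \<epsilon> (\<lambda>i. Y i \<omega>) b"
        if "\<kappa> < sqrt (real n) * - ((1 / real n) *
          (\<Sum>i\<in>{1..n}. (2 * Y i \<omega> - 1) * - of_bool (X i \<bullet> b \<le> 0 \<and> X i \<bullet> v > 0)))" for \<omega>
        using that[folded eq] v assms unfolding \<kappa>_def by (intro test_stat_gt) blast+
    qed simp
  qed
qed

theorem corollary2:
  fixes M :: "'w::topological_space measure"
    and n :: nat
    and X :: "nat \<Rightarrow> real ^ 'k"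
    and B Vu Vl :: "(real ^ 'k) set"
    and Y U :: "nat \<Rightarrow> 'w \<Rightarrow> real"
    and b :: "real ^ 'k"
    and \<epsilon> \<alpha> \<gamma> :: real
  defines "q \<equiv> crit_value M n X Vu Vl \<epsilon> U \<alpha> b"
    and "Q \<equiv> violation M n X Vu Vl Y b"
    and "rejection_prob \<equiv>
           \<P>(\<omega> in M. test_stat n X Vu Vl \<epsilon> (\<lambda>i. Y i \<omega>) b > crit_value M n X Vu Vl \<epsilon> U \<alpha> b)"
  assumes "n \<ge> 1"
    and "binary_response_model M n X B Y U"
    and "independent_errors M n U"
    and "Vu \<noteq> {}" and "Vl \<noteq> {}"
    and "\<epsilon> > 0"
    and "0 < \<alpha>" and "\<alpha> < 1"
    and "b \<in> B"
    and "0 < \<gamma>" and "\<gamma> < 1"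
  shows "(Q \<ge> C_bound n \<epsilon> q \<gamma> \<longrightarrow> rejection_prob \<ge> \<gamma>) \<and>
         (b \<notin> identified_set M n X B Y \<longrightarrow>
           rejection_prob \<ge> 1 - exp (- (1 / 2) *
             (max 0 (sqrt (real n) * Q - q * max \<epsilon> ((1 + q\<^sup>2 / real n) powr (- 1 / 2))))\<^sup>2))"
proof -
  define \<kappa> where "\<kappa> = q * max \<epsilon> ((1 + q\<^sup>2 / real n) powr (- 1 / 2))"
  have "q \<ge> 0"
    using assms(5,10,11) unfolding q_def binary_response_model_def by (intro crit_value_nonneg) auto
  then have bound: "rejection_prob \<ge> 1 - exp (- (1 / 2) * (max 0 (sqrt (real n) * Q - \<kappa>))\<^sup>2)"
    unfolding rejection_prob_def q_def[symmetric] Q_def \<kappa>_def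
    using assms(4-9) by (intro rejection_prob_ge)
  have "rejection_prob \<ge> \<gamma>" if "Q \<ge> C_bound n \<epsilon> q \<gamma>"
  proof -
    \<comment> \<open>Chosen so that exp (- s^2 / 2) = 1 - \<gamma>. Multiplied by sqrt n, the
      hypothesis on \<open>Q\<close> reads \<kappa> + s \<le> sqrt n Q.\<close>
    define s where "s = sqrt (- 2 * ln (1 - \<gamma>))"
    have "ln (1 - \<gamma>) \<le> 0" using assms by simp
    then have s: "s \<ge> 0" "s\<^sup>2 = - 2 * ln (1 - \<gamma>)" by (simp_all add: s_def)
    have "(\<kappa> + s) / sqrt (real n) \<le> Q"
      using that by (simp add: C_bound_def \<kappa>_def s_def)
    then have "s \<le> sqrt (real n) * Q - \<kappa>"
      using assms(4) by (simp add: pos_divide_le_eq mult.commute)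
    then have "s\<^sup>2 \<le> (max 0 (sqrt (real n) * Q - \<kappa>))\<^sup>2"
      using s by (intro power_mono) auto
    then have "exp (- (1 / 2) * (max 0 (sqrt (real n) * Q - \<kappa>))\<^sup>2) \<le> exp (ln (1 - \<gamma>))"
      using s by simp
    also have "\<dots> = 1 - \<gamma>" using assms by simp
    finally show ?thesis using bound by linarith
  qed
  then show ?thesis using bound unfolding \<kappa>_def by blast
qed

end
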